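(* Let convex functions $\theta_\nu\colon\mathbb{R}^n\to\mathbb{R}$ ($\nu\in\mathbb{N}$) be such that for each $\nu\in\mathbb{N}$: 1) $\theta_\nu(x)=\theta_\nu(|x_1|,\ldots,|x_n|)$ for $x=(x_1,\ldots,x_n)\in\mathbb{R}^n$; 2) the restriction of $\theta_\nu$ to $[0,\infty)^n$ is nondecreasing in each variable; 3) there exists a constant $a_\nu>0$ such that $|\varphi_\nu(x)-\theta_\nu(x)|\le a_\nu$ for all $x\in\mathbb{R}^n$. Then $G(\mathcal{H})=GS(\varPhi^* )$ (equality of the spaces with their topologies).
   Context: Notation: $n\in\mathbb{N}$ is fixed, $\|\cdot\|$ is the Euclidean norm, $\langle u,v\rangle=u_1v_1+\cdots+u_nv_n$; for multi-indices $\alpha\in\mathbb{Z}_+^n$: $|\alpha|=\alpha_1+\cdots+\alpha_n$, $\alpha!=\alpha_1!\cdots\alpha_n!$, $x^\alpha=x_1^{\alpha_1}\cdots x_n^{\alpha_n}$, $D^\alpha=\partial^{|\alpha|}/\partial x_1^{\alpha_1}\cdots\partial x_n^{\alpha_n}$. For $g\colon\mathbb{R}^n\to[-\infty,+\infty]$, $g^*(x)=\sup_{y\in\mathbb{R}^n}(\langle x,y\rangle-g(y))$. $\mathcal{H}=\{h_\nu\}_{\nu=1}^\infty$ is a fixed family of convex functions $h_\nu\colon\mathbb{R}^n\to\mathbb{R}$ such that for each $\nu\in\mathbb{N}$: 1) $h_\nu(x)=h_\nu(|x_1|,\ldots,|x_n|)$ for $x\in\mathbb{R}^n$; 2) the restriction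 of $h_\nu$ to $[0,\infty)^n$ is nondecreasing in each variable; 3) $\lim_{x\to\infty} h_\nu(x)/\|x\|=+\infty$; 4) for each $M>0$ there exists a constant $A_{\nu,M}>0$ such that $h_\nu(x)\le\sum_{1\le j\le n:\,x_j\ne0}x_j\ln\frac{x_j}{M}+A_{\nu,M}$ for $x\in[0,\infty)^n$; 5) there is a constant $\gamma_\nu$ with $h_\nu(x)-h_{\nu+1}(x)\ge\ln2\cdot\sum_{j=1}^n x_j-\gamma_\nu$ for $x\in[0,\infty)^n$; 6) there is a constant $l_\nu$ with $h_{\nu+1}(x+y)\le h_\nu(x)+h_\nu(y)+l_\nu$ for $x,y\in[0,\infty)^n$. For $\nu\in\mathbb{N}$, $m\in\mathbb{Z}_+$, let $$G_m(h_\nu)=\Big\{f\in C^m(\mathbb{R}^n):\ \|f\|_{m,h_\nu}=\sup_{x\in\mathbb{R}^n,\ \beta\in\mathbb{Z}_+^n,\ |\alpha|\le m}\frac{|x^\beta(D^\alpha f)(x)|}{\beta!\,e^{-h_\nu(\beta)}}<\infty\Big\},$$ $G(h_\nu)=\bigcap_{m\ge0}G_m(h_\nu)$ with the topology defined by the norms $\|\cdot\|_{m,h_\nu}$ ($m\in\mathbb{Z}_+$), and $G(\mathcal{H})=\bigcup_{\nu\ge1}G(h_\nu)$ with the inductive limit topology of the spaces $G(h_\nu)$. For $\nu\in\mathbb{N}$ let $\varphi_\nu(x)=h_\nu^*(\ln(1+|x_1|),\ldots,\ln(1+|x_n|))$, $x\in\mathbb{R}^n$; $\varPhi=\{\varphi_\nu\}_{\nu=1}^\infty$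 and $\varPhi^*=\{\varphi_\nu^*\}_{\nu=1}^\infty$, where $\varphi_\nu^*$ is the Young–Fenchel conjugate of $\varphi_\nu$ (finite on $\mathbb{R}^n$, since $\varphi_\nu(x)/\|x\|\to+\infty$ as $x\to\infty$). For a family $\mathcal{M}=\{M_\nu\}_{\nu=1}^\infty$ of functions $M_\nu\colon\mathbb{R}^n\to\mathbb{R}$ (here $M_\nu=\varphi_\nu^*$) and $m\in\mathbb{Z}_+$ let $$GS_m(M_\nu)=\Big\{f\in C^m(\mathbb{R}^n):\ q_{m,\nu}(f)=\sup_{x\in\mathbb{R}^n,\ |\alpha|\le m}\frac{|(D^\alpha f)(x)|}{e^{-M_\nu(x)}}<\infty\Big\},$$ $GS(M_\nu)=\bigcap_{m\ge0}GS_m(M_\nu)$ with the topology defined by the norms $q_{m,\nu}$ ($m\in\mathbb{Z}_+$), and $GS(\mathcal{M})=\bigcup_{\nu\ge1}GS(M_\nu)$ with the inductive limit topology of the spaces $GS(M_\nu)$. Inductive limits are taken in the locally convex sense. *)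

theory Defs
  imports "HOL-Analysis.Analysis"
begin

section \<open>Multi-indices and partial derivatives\<close>

text \<open>
  Multi-indices are elements of \<^typ>\<open>nat ^ 'n\<close>. The index type carries a linear order only so
  that iterated partial derivatives can be taken in a definite order; its cardinality is the
  dimension.
\<close>

definition mi_abs :: "nat ^ 'n::finite \<Rightarrow> nat" where
  "mi_abs \<alpha> = (\<Sum>i\<in>UNIV. \<alpha> $ i)"

definition mi_fact :: "nat ^ 'n::finite \<Rightarrow> real" where
  "mi_fact \<alpha> = (\<Prod>i\<in>UNIV. fact (\<alpha> $ i))"

definition mi_power :: "real ^ 'n::finite \<Rightarrow> nat ^ 'n \<Rightarrow> real" where
  "mi_power x \<alpha> = (\<Prod>i\<in>UNIV. (x $ i) ^ (\<alpha> $ i))"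

definition mi_vec :: "nat ^ 'n::finite \<Rightarrow> real ^ 'n" where
  "mi_vec \<alpha> = (\<chi> i. real (\<alpha> $ i))"

definition pderiv_dir :: "'n::finite \<Rightarrow> (real ^ 'n \<Rightarrow> complex) \<Rightarrow> real ^ 'n \<Rightarrow> complex" where
  "pderiv_dir i f x = vector_derivative (\<lambda>t. f (x + t *\<^sub>R axis i 1)) (at 0)"

text \<open>The innermost (first applied) derivatives are those in the largest index.\<close>

definition mi_deriv ::
  "nat ^ 'n::{finite,linorder} \<Rightarrow> (real ^ 'n::{finite,linorder} \<Rightarrow> complex) \<Rightarrow>
    real ^ 'n::{finite,linorder} \<Rightarrow> complex" where
  "mi_deriv \<alpha> f = foldr (\<lambda>i. pderiv_dir i ^^ (\<alpha> $ i)) (sorted_list_of_set UNIV) f"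

primrec C_class :: "nat \<Rightarrow> (real ^ 'n::finite \<Rightarrow> complex) \<Rightarrow> bool" where
  "C_class 0 f \<longleftrightarrow> continuous_on UNIV f"
| "C_class (Suc m) f \<longleftrightarrow> continuous_on UNIV f \<and>
     (\<forall>i. (\<forall>x. (\<lambda>t. f (x + t *\<^sub>R axis i 1)) differentiable (at 0)) \<and>
          C_class m (pderiv_dir i f))"


section \<open>Conjugates and monotonicity\<close>

definition young_conj :: "(real ^ 'n::finite \<Rightarrow> ereal) \<Rightarrow> real ^ 'n \<Rightarrow> ereal" where
  "young_conj g x = (SUP y. ereal (x \<bullet> y) - g y)"

definition orthant :: "(real ^ 'n::finite) set" where
  "orthant = {x. \<forall>i. 0 \<le> x $ i}"

definition nondecr_each_var :: "(real ^ 'n::finite \<Rightarrow> real) \<Rightarrow> bool" where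
  "nondecr_each_var g \<longleftrightarrow>
     (\<forall>x\<in>orthant. \<forall>i t. x $ i \<le> t \<longrightarrow> g x \<le> g (\<chi> j. if j = i then t else x $ j))"

text \<open>
  The coercion \<^const>\<open>real_of_ereal\<close> is only ever applied to finite values for the functions
  under consideration, see \<open>superlinear_bounded_below\<close>, \<open>young_conj_finite\<close> and
  \<open>phi_superlinear\<close> below.
\<close>

definition real_conj :: "(real ^ 'n::finite \<Rightarrow> real) \<Rightarrow> real ^ 'n \<Rightarrow> real" where
  "real_conj g x = real_of_ereal (young_conj (\<lambda>y. ereal (g y)) x)"

definition phi :: "(real ^ 'n::finite \<Rightarrow> real) \<Rightarrow> real ^ 'n \<Rightarrow> real" where
  "phi h x = real_conj h (\<chi> i. ln (1 + \<bar>x $ i\<bar>))"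


lemma superlinear_bounded_below:
  fixes g :: "real ^ 'n::finite \<Rightarrow> real"
  assumes cont: "continuous_on UNIV g"
    and sup: "filterlim (\<lambda>x. g x / norm x) at_top at_infinity"
  shows "\<exists>c. \<forall>x. c \<le> g x"
proof -
  have "eventually (\<lambda>x. 0 \<le> g x / norm x) at_infinity"
    using sup unfolding filterlim_at_top by blast
  then obtain b where b: "\<And>x. norm x \<ge> b \<Longrightarrow> 0 \<le> g x / norm x"
    unfolding eventually_at_infinity by blast
  define r where "r = max b 1"
  have pos: "0 \<le> g x" if "norm x \<ge> r" for x
    using b[of x] that by (auto simp: r_def zero_le_divide_iff)
  have "compact (g ` cball 0 r)"
    using cont by (intro compact_continuous_image) (auto intro: continuous_on_subset)
  then have "bounded (g ` cball 0 r)"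
    by (rule compact_imp_bounded)
  then obtain B where B: "\<And>x. norm x \<le> r \<Longrightarrow> \<bar>g x\<bar> \<le> B"
    unfolding bounded_iff by fastforce
  have "min 0 (- B) \<le> g x" for x
    using pos[of x] B[of x] by (cases "norm x \<le> r") (auto simp: min_def)
  then show ?thesis by blast
qed

lemma young_conj_finite:
  fixes g :: "real ^ 'n::finite \<Rightarrow> real"
  assumes below: "\<exists>c. \<forall>x. c \<le> g x"
    and sup: "filterlim (\<lambda>x. g x / norm x) at_top at_infinity"
  shows "\<bar>young_conj (\<lambda>y. ereal (g y)) x\<bar> \<noteq> \<infinity>"
proof -
  obtain c where c: "\<And>x. c \<le> g x" using below by blast
  have "eventually (\<lambda>y. norm x \<le> g y / norm y) at_infinity"
    using sup unfolding filterlim_at_top by blast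
  then obtain b where b: "\<And>y. norm y \<ge> b \<Longrightarrow> norm x \<le> g y / norm y"
    unfolding eventually_at_infinity by blast
  define r where "r = max b 1"
  define d where "d = max 0 (norm x * r - c)"
  have le: "x \<bullet> y - g y \<le> d" for y
  proof (cases "norm y \<ge> r")
    case True
    then have "norm x * norm y \<le> g y"
      using b[of y] pos_le_divide_eq[of "norm y" "norm x" "g y"] unfolding r_def by linarith
    moreover have "x \<bullet> y \<le> norm x * norm y" by (rule norm_cauchy_schwarz)
    ultimately show ?thesis unfolding d_def by linarith
  next
    case False
    then have "norm x * norm y \<le> norm x * r" by (intro mult_left_mono) auto
    moreover have "x \<bullet> y \<le> norm x * norm y" by (rule norm_cauchy_schwarz)
    ultimately show ?thesis using c[of y] unfolding d_def by linarith
  qed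
  have "young_conj (\<lambda>y. ereal (g y)) x \<le> ereal d"
    unfolding young_conj_def by (rule SUP_least) (simp only: ereal_minus(1) ereal_less_eq(3) le)
  moreover have "ereal (x \<bullet> 0 - g 0) \<le> young_conj (\<lambda>y. ereal (g y)) x"
    unfolding young_conj_def by (rule SUP_upper2[of 0]) auto
  ultimately show ?thesis by auto
qed

lemma real_conj_ge:
  fixes g :: "real ^ 'n::finite \<Rightarrow> real"
  assumes "\<bar>young_conj (\<lambda>y. ereal (g y)) x\<bar> \<noteq> \<infinity>"
  shows "x \<bullet> y - g y \<le> real_conj g x"
proof -
  have "ereal (x \<bullet> y - g y) \<le> young_conj (\<lambda>y. ereal (g y)) x"
    unfolding young_conj_def by (rule SUP_upper2[of y]) auto
  then show ?thesis
    using assms unfolding real_conj_def by (metis ereal_real ereal_less_eq(3))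
qed

lemma phi_superlinear:
  fixes h :: "real ^ 'n::finite \<Rightarrow> real"
  assumes conv: "convex_on UNIV h"
    and sup: "filterlim (\<lambda>x. h x / norm x) at_top at_infinity"
    and upper: "\<And>M. M > 0 \<Longrightarrow>
       \<exists>A>0. \<forall>x\<in>orthant. h x \<le> (\<Sum>j | x $ j \<noteq> 0. x $ j * ln (x $ j / M)) + A"
  shows "\<exists>c. \<forall>x. c \<le> phi h x"
    and "filterlim (\<lambda>x. phi h x / norm x) at_top at_infinity"
proof -
  have cont: "continuous_on UNIV h"
    using conv by (intro convex_on_continuous) auto
  have fin: "\<bar>young_conj (\<lambda>y. ereal (h y)) z\<bar> \<noteq> \<infinity>" for z
    by (rule young_conj_finite[OF superlinear_bounded_below[OF cont sup] sup])
  have "- h 0 \<le> phi h x" for x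
    using real_conj_ge[OF fin, of _ 0] by (simp add: phi_def)
  then show "\<exists>c. \<forall>x. c \<le> phi h x" by blast
  have lower: "\<exists>A. \<forall>x. M * norm x - A \<le> phi h x" if M: "M > 0" for M
  proof -
    from upper[of "exp 1 * M"] M obtain A where
      A: "\<And>y. y \<in> orthant \<Longrightarrow> h y \<le> (\<Sum>j | y $ j \<noteq> 0. y $ j * ln (y $ j / (exp 1 * M))) + A"
      by auto
    have "M * norm x - A \<le> phi h x" for x
    proof -
      define z :: "real ^ 'n" where "z = (\<chi> i. ln (1 + \<bar>x $ i\<bar>))"
      define y :: "real ^ 'n" where "y = (\<chi> i. M * (1 + \<bar>x $ i\<bar>))"
      have ypos: "y $ i > 0" for i
        using M by (auto simp: y_def intro!: mult_pos_pos add_pos_nonneg)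
      have "h y \<le> (\<Sum>j | y $ j \<noteq> 0. y $ j * ln (y $ j / (exp 1 * M))) + A"
        by (rule A) (use ypos in \<open>auto simp: orthant_def less_imp_le\<close>)
      also have "{j. y $ j \<noteq> 0} = UNIV"
        using ypos by (metis (mono_tags, lifting) UNIV_eq_I less_irrefl mem_Collect_eq)
      also have "(\<Sum>j\<in>UNIV. y $ j * ln (y $ j / (exp 1 * M))) = (\<Sum>j\<in>UNIV. y $ j * (z $ j - 1))"
      proof (rule sum.cong)
        fix j
        have "y $ j / (exp 1 * M) = (1 + \<bar>x $ j\<bar>) / exp 1"
          using M by (simp add: y_def)
        also have "ln \<dots> = z $ j - 1"
          by (subst ln_div) (auto simp: z_def)
        finally show "y $ j * ln (y $ j / (exp 1 * M)) = y $ j * (z $ j - 1)" by simp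
      qed simp
      also have "\<dots> = z \<bullet> y - (\<Sum>j\<in>UNIV. y $ j)"
        by (simp add: inner_vec_def algebra_simps sum_subtractf)
      finally have "(\<Sum>j\<in>UNIV. y $ j) - A \<le> z \<bullet> y - h y" by simp
      also have "\<dots> \<le> phi h x"
        using real_conj_ge[OF fin] by (simp add: phi_def z_def)
      finally have 1: "(\<Sum>j\<in>UNIV. y $ j) - A \<le> phi h x" .
      have "M * norm x \<le> M * (\<Sum>j\<in>UNIV. \<bar>x $ j\<bar>)"
        using M norm_le_l1_cart[of x] by (intro mult_left_mono) auto
      also have "\<dots> \<le> (\<Sum>j\<in>UNIV. y $ j)"
        using M by (simp add: sum_distrib_left y_def) (intro sum_mono, simp)
      finally show ?thesis using 1 by linarith
    qed
    then show ?thesis by blast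
  qed
  show "filterlim (\<lambda>x. phi h x / norm x) at_top at_infinity"
    unfolding filterlim_at_top
  proof
    fix Z :: real
    obtain A where A: "\<And>x. (\<bar>Z\<bar> + 1) * norm x - A \<le> phi h x"
      using lower[of "\<bar>Z\<bar> + 1"] abs_ge_zero[of Z] by fastforce
    have "Z \<le> phi h x / norm x" if "norm x \<ge> max 1 A" for x
    proof -
      have "Z * norm x \<le> \<bar>Z\<bar> * norm x" by (intro mult_right_mono) auto
      also have "\<dots> \<le> (\<bar>Z\<bar> + 1) * norm x - A" using that by (simp add: algebra_simps)
      also have "\<dots> \<le> phi h x" by (rule A)
      finally show ?thesis
        using that pos_le_divide_eq[of "norm x" Z "phi h x"] by linarith
    qed
    then show "eventually (\<lambda>x. Z \<le> phi h x / norm x) at_infinity"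
      unfolding eventually_at_infinity by blast
  qed
qed


section \<open>Topologies on spaces of functions\<close>

text \<open>
  The topology on \<open>E\<close> defined by the seminorms \<open>p m\<close>: all seminorm balls, with arbitrary centres
  in \<open>E\<close>, form a subbase.
\<close>

definition seminorm_topology ::
  "('a \<Rightarrow> complex) set \<Rightarrow> (nat \<Rightarrow> ('a \<Rightarrow> complex) \<Rightarrow> ereal) \<Rightarrow> ('a \<Rightarrow> complex) topology" where
  "seminorm_topology E p =
     topology_generated_by
       {{g \<in> E. p m (\<lambda>x. g x - f x) < ereal r} | f m r. f \<in> E \<and> 0 < r}"

definition convex_funs :: "('a \<Rightarrow> complex) set \<Rightarrow> bool" where
  "convex_funs V \<longleftrightarrow>
     (\<forall>f\<in>V. \<forall>g\<in>V. \<forall>t\<in>{0..1::real}. (\<lambda>x. of_real (1 - t) * f x + of_real t * g x) \<in> V)"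

definition subspace_funs :: "('a \<Rightarrow> complex) set \<Rightarrow> bool" where
  "subspace_funs E \<longleftrightarrow> (\<lambda>x. 0) \<in> E \<and> (\<forall>f\<in>E. \<forall>g\<in>E. (\<lambda>x. f x + g x) \<in> E) \<and>
     (\<forall>c. \<forall>f\<in>E. (\<lambda>x. c * f x) \<in> E)"

definition locally_convex_on :: "('a \<Rightarrow> complex) set \<Rightarrow> ('a \<Rightarrow> complex) topology \<Rightarrow> bool" where
  "locally_convex_on E T \<longleftrightarrow>
     topspace T = E \<and>
     continuous_map (prod_topology T T) T (\<lambda>(f, g). \<lambda>x. f x + g x) \<and>
     continuous_map (prod_topology euclidean T) T (\<lambda>(c::complex, f). \<lambda>x. c * f x) \<and>
     (\<forall>U. openin T U \<and> (\<lambda>x. 0) \<in> U \<longrightarrow>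
        (\<exists>V W. openin T W \<and> (\<lambda>x. 0) \<in> W \<and> W \<subseteq> V \<and> V \<subseteq> U \<and> convex_funs V))"

text \<open>
  The locally convex inductive limit of an increasing sequence of spaces \<open>X \<nu>\<close>: the
  supremum of all locally convex topologies on the union that make every inclusion continuous.
  If the union is a linear space, the supremum is itself such a topology, hence the finest one
  (\<open>lc_inductive_limit_finest\<close>).
\<close>

definition lc_candidate :: "(nat \<Rightarrow> ('a \<Rightarrow> complex) topology) \<Rightarrow> ('a \<Rightarrow> complex) topology \<Rightarrow> bool" where
  "lc_candidate X T \<longleftrightarrow>
     locally_convex_on (\<Union>\<nu>. topspace (X \<nu>)) T \<and> (\<forall>\<nu>. continuous_map (X \<nu>) T (\<lambda>f. f))"

definition lc_inductive_limit ::
  "(nat \<Rightarrow> ('a \<Rightarrow> complex) topology) \<Rightarrow> ('a \<Rightarrow> complex) topology" where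
  "lc_inductive_limit X = topology_generated_by {U. \<exists>T. lc_candidate X T \<and> openin T U}"

lemma lc_inductive_limit_finest:
  assumes sub: "subspace_funs (\<Union>\<nu>. topspace (X \<nu>))"
  shows "lc_candidate X (lc_inductive_limit X)"
    and "lc_candidate X T \<Longrightarrow> openin T U \<Longrightarrow> openin (lc_inductive_limit X) U"
proof -
  define E where "E = (\<Union>\<nu>. topspace (X \<nu>))"
  let ?S = "{U. \<exists>T. lc_candidate X T \<and> openin T U}"
  let ?L = "lc_inductive_limit X"
  have zero: "(\<lambda>x. 0) \<in> E"
    and add: "\<And>f g. f \<in> E \<Longrightarrow> g \<in> E \<Longrightarrow> (\<lambda>x. f x + g x) \<in> E"
    and scale: "\<And>c f. f \<in> E \<Longrightarrow> (\<lambda>x. c * f x) \<in> E"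
    using sub by (auto simp: subspace_funs_def E_def)
  have finer: "openin ?L U" if "lc_candidate X T" "openin T U" for T U
    unfolding lc_inductive_limit_def by (rule topology_generated_by_Basis) (use that in blast)
  then show "lc_candidate X T \<Longrightarrow> openin T U \<Longrightarrow> openin (lc_inductive_limit X) U" .
  define I where "I = topology (\<lambda>U. U = {} \<or> U = E)"
  have "istopology (\<lambda>U. U = {} \<or> U = E)"
    unfolding istopology_def by blast
  then have openI: "openin I U \<longleftrightarrow> U = {} \<or> U = E" for U
    unfolding I_def by (simp add: topology_inverse')
  have topI: "topspace I = E"
    using openI[of E] openI[of "topspace I"] openin_subset[of I E] by auto
  have contI: "continuous_map Y I f" if f: "\<And>y. y \<in> topspace Y \<Longrightarrow> f y \<in> E"
    for Y and f :: "'z \<Rightarrow> 'a \<Rightarrow> complex"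
  proof -
    have "{y \<in> topspace Y. f y \<in> E} = topspace Y" using f by blast
    then show ?thesis
      unfolding continuous_map_def topI openI using f by auto
  qed
  have convE: "convex_funs E"
    unfolding convex_funs_def by (intro ballI add scale)
  have candI: "lc_candidate X I"
    unfolding lc_candidate_def locally_convex_on_def
  proof (intro conjI allI impI)
    show "topspace I = (\<Union>\<nu>. topspace (X \<nu>))" by (simp add: topI E_def)
    show "continuous_map (prod_topology I I) I (\<lambda>(f, g) x. f x + g x)"
      by (rule contI) (use add in \<open>auto simp: topI\<close>)
    show "continuous_map (prod_topology euclidean I) I (\<lambda>(c, f) x. c * f x)"
      by (rule contI) (use scale in \<open>auto simp: topI\<close>)
    show "continuous_map (X \<nu>) I (\<lambda>f. f)" for \<nu>
      by (rule contI) (auto simp: E_def)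
    show "\<exists>V W. openin I W \<and> (\<lambda>x. 0) \<in> W \<and> W \<subseteq> V \<and> V \<subseteq> U \<and> convex_funs V"
      if "openin I U \<and> (\<lambda>x. 0) \<in> U" for U
      using that convE unfolding openI by blast
  qed
  have top_cand: "topspace T = E" if "lc_candidate X T" for T
    using that by (simp add: lc_candidate_def locally_convex_on_def E_def)
  have US: "\<Union>?S = E"
  proof
    show "\<Union>?S \<subseteq> E" using top_cand openin_subset by blast
    show "E \<subseteq> \<Union>?S" using candI openI by blast
  qed
  have topL: "topspace ?L = E"
    unfolding lc_inductive_limit_def using US by simp
  have contL: "continuous_map Y ?L f" if f: "\<And>T. lc_candidate X T \<Longrightarrow> continuous_map Y T f"
    for Y and f :: "'z \<Rightarrow> 'a \<Rightarrow> complex"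
    unfolding lc_inductive_limit_def
  proof (rule continuous_on_generated_topo)
    fix U assume "U \<in> ?S"
    then obtain T where T: "lc_candidate X T" "openin T U" by blast
    have "openin Y {x \<in> topspace Y. f x \<in> U}"
      by (rule openin_continuous_map_preimage[OF f[OF T(1)] T(2)])
    moreover have "{x \<in> topspace Y. f x \<in> U} = f -` U \<inter> topspace Y" by auto
    ultimately show "openin Y (f -` U \<inter> topspace Y)" by simp
  next
    show "f ` topspace Y \<subseteq> \<Union>?S"
      unfolding US using continuous_map_image_subset_topspace[OF f[OF candI]] topI by simp
  qed
  have idL: "continuous_map ?L T (\<lambda>f. f)" if "lc_candidate X T" for T
    using topology_finer_continuous_id[of T ?L] finer[OF that] top_cand[OF that] topL
    by (simp add: id_def)
  have base: "\<exists>V W. openin ?L W \<and> (\<lambda>x. 0) \<in> W \<and> W \<subseteq> V \<and> V \<subseteq> U \<and> convex_funs V"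
    if "generate_topology_on ?S U" "(\<lambda>x. 0) \<in> U" for U
    using that
  proof (induction rule: generate_topology_on.induct)
    case Empty
    then show ?case by simp
  next
    case (Int a b)
    from Int.IH(1) Int.prems obtain V W where 1:
      "openin ?L W" "(\<lambda>x. 0) \<in> W" "W \<subseteq> V" "V \<subseteq> a" "convex_funs V" by blast
    from Int.IH(2) Int.prems obtain V' W' where 2:
      "openin ?L W'" "(\<lambda>x. 0) \<in> W'" "W' \<subseteq> V'" "V' \<subseteq> b" "convex_funs V'" by blast
    have "convex_funs (V \<inter> V')"
      using 1(5) 2(5) unfolding convex_funs_def by blast
    with 1 2 show ?case
      by (intro exI[of _ "V \<inter> V'"] exI[of _ "W \<inter> W'"]) (auto intro: openin_Int)
  next
    case (UN K)
    then obtain k where k: "k \<in> K" "(\<lambda>x. 0) \<in> k" by blast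
    from UN.IH[OF k] k(1) show ?case by (meson Sup_upper subset_trans)
  next
    case (Basis s)
    then obtain T where T: "lc_candidate X T" "openin T s" by blast
    then obtain V W where "openin T W" "(\<lambda>x. 0) \<in> W" "W \<subseteq> V" "V \<subseteq> s" "convex_funs V"
      using Basis.prems unfolding lc_candidate_def locally_convex_on_def by meson
    then show ?case using finer[OF T(1)] by blast
  qed
  show "lc_candidate X ?L"
    unfolding lc_candidate_def locally_convex_on_def
  proof (intro conjI allI impI)
    show "topspace ?L = (\<Union>\<nu>. topspace (X \<nu>))" by (simp add: topL E_def)
    show "continuous_map (prod_topology ?L ?L) ?L (\<lambda>(f, g) x. f x + g x)"
    proof (rule contL)
      fix T assume T: "lc_candidate X T"
      have 1: "continuous_map (prod_topology ?L ?L) (prod_topology T T) (\<lambda>(f, g). (f, g))"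
        by (rule iffD2[OF continuous_map_prod_top]) (use idL[OF T] in blast)
      have 2: "continuous_map (prod_topology T T) T (\<lambda>(f, g) x. f x + g x)"
        using T by (simp add: lc_candidate_def locally_convex_on_def)
      show "continuous_map (prod_topology ?L ?L) T (\<lambda>(f, g) x. f x + g x)"
        using continuous_map_compose[OF 1 2] by (simp add: o_def case_prod_unfold)
    qed
    show "continuous_map (prod_topology euclidean ?L) ?L (\<lambda>(c, f) x. c * f x)"
    proof (rule contL)
      fix T assume T: "lc_candidate X T"
      have 1: "continuous_map (prod_topology euclidean ?L) (prod_topology euclidean T)
                (\<lambda>(c::complex, f). (c, f))"
        by (rule iffD2[OF continuous_map_prod_top])
           (use idL[OF T] continuous_map_id in \<open>simp add: id_def\<close>)
      have 2: "continuous_map (prod_topology euclidean T) T (\<lambda>(c::complex, f) x. c * f x)"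
        using T by (simp add: lc_candidate_def locally_convex_on_def)
      show "continuous_map (prod_topology euclidean ?L) T (\<lambda>(c, f) x. c * f x)"
        using continuous_map_compose[OF 1 2] by (simp add: o_def case_prod_unfold)
    qed
    show "continuous_map (X \<nu>) ?L (\<lambda>f. f)" for \<nu>
      by (rule contL) (simp add: lc_candidate_def)
    show "\<exists>V W. openin ?L W \<and> (\<lambda>x. 0) \<in> W \<and> W \<subseteq> V \<and> V \<subseteq> U \<and> convex_funs V"
      if "openin ?L U \<and> (\<lambda>x. 0) \<in> U" for U
      using that base unfolding lc_inductive_limit_def by (simp add: openin_topology_generated_by_iff)
  qed
qed


section \<open>The two scales of spaces\<close>

definition G_norm ::
  "(real ^ 'n::{finite,linorder} \<Rightarrow> real) \<Rightarrow> nat \<Rightarrow> (real ^ 'n::{finite,linorder} \<Rightarrow> complex) \<Rightarrow> ereal" where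
  "G_norm h m f =
     (SUP (x, \<beta>, \<alpha>) \<in> {(x, \<beta>, \<alpha>). mi_abs \<alpha> \<le> m}.
        ereal (cmod (of_real (mi_power x \<beta>) * mi_deriv \<alpha> f x) / (mi_fact \<beta> * exp (- h (mi_vec \<beta>)))))"

definition G_m_space ::
  "(real ^ 'n::{finite,linorder} \<Rightarrow> real) \<Rightarrow> nat \<Rightarrow> (real ^ 'n::{finite,linorder} \<Rightarrow> complex) set" where
  "G_m_space h m = {f. C_class m f \<and> G_norm h m f < \<infinity>}"

definition G_space :: "(real ^ 'n::{finite,linorder} \<Rightarrow> real) \<Rightarrow> (real ^ 'n::{finite,linorder} \<Rightarrow> complex) set" where
  "G_space h = (\<Inter>m. G_m_space h m)"

definition G_limit ::
  "(nat \<Rightarrow> real ^ 'n::{finite,linorder} \<Rightarrow> real) \<Rightarrow> (real ^ 'n::{finite,linorder} \<Rightarrow> complex) topology" where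
  "G_limit H = lc_inductive_limit (\<lambda>\<nu>. seminorm_topology (G_space (H \<nu>)) (G_norm (H \<nu>)))"

definition GS_norm ::
  "(real ^ 'n::{finite,linorder} \<Rightarrow> real) \<Rightarrow> nat \<Rightarrow> (real ^ 'n::{finite,linorder} \<Rightarrow> complex) \<Rightarrow> ereal" where
  "GS_norm M m f =
     (SUP (x, \<alpha>) \<in> {(x, \<alpha>). mi_abs \<alpha> \<le> m}. ereal (cmod (mi_deriv \<alpha> f x) / exp (- M x)))"

definition GS_m_space ::
  "(real ^ 'n::{finite,linorder} \<Rightarrow> real) \<Rightarrow> nat \<Rightarrow> (real ^ 'n::{finite,linorder} \<Rightarrow> complex) set" where
  "GS_m_space M m = {f. C_class m f \<and> GS_norm M m f < \<infinity>}"

definition GS_space :: "(real ^ 'n::{finite,linorder} \<Rightarrow> real) \<Rightarrow> (real ^ 'n::{finite,linorder} \<Rightarrow> complex) set" where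
  "GS_space M = (\<Inter>m. GS_m_space M m)"

definition GS_limit ::
  "(nat \<Rightarrow> real ^ 'n::{finite,linorder} \<Rightarrow> real) \<Rightarrow> (real ^ 'n::{finite,linorder} \<Rightarrow> complex) topology" where
  "GS_limit M = lc_inductive_limit (\<lambda>\<nu>. seminorm_topology (GS_space (M \<nu>)) (GS_norm (M \<nu>)))"

end

theory Submission
  imports Defs
begin

text \<open>
  Both scales are weighted sup norms of the derivatives, so it suffices to compare the weights
  \<open>|x\<^sup>\<beta>| e\<^bsup>h(\<beta>)\<^esup> / \<beta>!\<close> with \<open>e\<^bsup>\<phi>*(x)\<^esup>\<close>, losing one step in the index.
  In one direction, \<open>u\<^sup>k / k! \<le> e\<^sup>u\<close> gives \<open>|x\<^sup>\<beta>| \<le> \<beta>! e\<^bsup>|x|\<cdot>y\<^esup> y\<^bsup>-\<beta>\<^esup>\<close>, and one takes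
  \<open>y = e\<^sup>t\<close> with \<open>t \<ge> 0\<close> an approximate subgradient of \<open>h\<close> at \<open>\<beta>\<close>. In the other direction,
  some term of the exponential series satisfies \<open>e\<^sup>u \<le> 4 (2u)\<^sup>k / k!\<close>; with \<open>u = |x\<^sub>j y\<^sub>j|\<close>
  Young's inequality \<open>\<phi>(y) \<ge> \<beta> \<cdot> ln(1 + |y|) - h(\<beta>)\<close> absorbs \<open>|y\<^sup>\<beta>|\<close>, and the
  gap condition on \<open>h\<close> absorbs \<open>2\<^bsup>|\<beta>|\<^esup>\<close>. Mutually continuous inclusions between two
  sequences of spaces give the same inductive limit.
\<close>

section \<open>Linearity of iterated partial derivatives\<close>

definition C_infty :: "(real ^ 'n::finite \<Rightarrow> complex) \<Rightarrow> bool" where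
  "C_infty f \<longleftrightarrow> (\<forall>m. C_class m f)"

lemma C_infty_pderiv_dir:
  assumes "C_infty f"
  shows "C_infty (pderiv_dir i f)"
  using assms unfolding C_infty_def by (metis C_class.simps(2))

lemma C_infty_differentiable:
  assumes "C_infty f"
  shows "(\<lambda>t. f (x + t *\<^sub>R axis i 1)) differentiable (at 0)"
  using assms unfolding C_infty_def by (metis C_class.simps(2))

lemma C_infty_pderiv_dir_funpow: "C_infty f \<Longrightarrow> C_infty ((pderiv_dir i ^^ k) f)"
  by (induction k) (auto intro: C_infty_pderiv_dir)

lemma C_infty_foldr_pderiv_dir:
  "C_infty f \<Longrightarrow> C_infty (foldr (\<lambda>i. pderiv_dir i ^^ k i) is f)"
  by (induction "is") (auto intro: C_infty_pderiv_dir_funpow)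

text \<open>\<open>vector_derivative\<close> respects differences only where both derivatives exist;
  smoothness guarantees this at every point.\<close>

lemma pderiv_dir_diff:
  assumes "C_infty f" "C_infty g"
  shows "pderiv_dir i (\<lambda>x. f x - g x) = (\<lambda>x. pderiv_dir i f x - pderiv_dir i g x)"
  unfolding pderiv_dir_def
  by (intro ext vector_derivative_diff_at C_infty_differentiable assms)

lemma pderiv_dir_funpow_diff:
  assumes "C_infty f" "C_infty g"
  shows "(pderiv_dir i ^^ k) (\<lambda>x. f x - g x) =
    (\<lambda>x. (pderiv_dir i ^^ k) f x - (pderiv_dir i ^^ k) g x)"
  by (induction k) (simp_all add: pderiv_dir_diff C_infty_pderiv_dir_funpow assms)

text \<open>The seminorm balls have arbitrary centres, so derivatives of differences must be split
  before norms can be compared. The induction runs over an arbitrary list of directions, keeping all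
  intermediate functions smooth.\<close>

lemma mi_deriv_diff:
  assumes "C_infty f" "C_infty g"
  shows "mi_deriv \<alpha> (\<lambda>x. f x - g x) = (\<lambda>x. mi_deriv \<alpha> f x - mi_deriv \<alpha> g x)"
proof -
  have "foldr (\<lambda>i. pderiv_dir i ^^ (\<alpha> $ i)) is (\<lambda>x. f x - g x) =
    (\<lambda>x. foldr (\<lambda>i. pderiv_dir i ^^ (\<alpha> $ i)) is f x - foldr (\<lambda>i. pderiv_dir i ^^ (\<alpha> $ i)) is g x)"
    for "is"
    by (induction "is")
       (simp_all add: pderiv_dir_funpow_diff C_infty_foldr_pderiv_dir assms)
  then show ?thesis unfolding mi_deriv_def .
qed


section \<open>Weighted sup norms\<close>

text \<open>Common form of \<open>G_norm\<close> and \<open>GS_norm\<close>. The parameter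
  \<open>k\<close> is the multi-index \<beta> for the former and a dummy for the latter.\<close>

definition weighted_norm ::
  "('k \<Rightarrow> real ^ 'n::{finite,linorder} \<Rightarrow> real) \<Rightarrow> nat \<Rightarrow> (real ^ 'n::{finite,linorder} \<Rightarrow> complex) \<Rightarrow> ereal" where
  "weighted_norm w m f =
     (SUP (k, x, \<alpha>) \<in> {(k, x, \<alpha>). mi_abs \<alpha> \<le> m}. ereal (w k x * cmod (mi_deriv \<alpha> f x)))"

lemma weighted_norm_upper:
  assumes "mi_abs \<alpha> \<le> m"
  shows "ereal (w k x * cmod (mi_deriv \<alpha> f x)) \<le> weighted_norm w m f"
  unfolding weighted_norm_def by (rule SUP_upper2[of "(k, x, \<alpha>)"]) (use assms in auto)

lemma weighted_norm_least:
  assumes "\<And>k x \<alpha>. mi_abs \<alpha> \<le> m \<Longrightarrow> ereal (w k x * cmod (mi_deriv \<alpha> f x)) \<le> B"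
  shows "weighted_norm w m f \<le> B"
  unfolding weighted_norm_def by (rule SUP_least) (use assms in auto)

lemma weighted_norm_nonneg:
  assumes "\<And>k x. 0 \<le> w k x"
  shows "0 \<le> weighted_norm w m f"
proof -
  \<comment> \<open>Any index triple would do; \<alpha> = 0 is admissible for every
    \<open>m\<close>.\<close>
  have "0 \<le> ereal (w undefined 0 * cmod (mi_deriv 0 f 0))"
    using assms by simp
  also have "\<dots> \<le> weighted_norm w m f"
    by (rule weighted_norm_upper) (simp add: mi_abs_def)
  finally show ?thesis .
qed

text \<open>Since the supremum also runs over the parameter, \<open>k'\<close> may depend on the
  point \<open>x\<close>. This freedom is essential when a single weight is dominated by the family
  indexed by \<beta>.\<close>

lemma weighted_norm_le:
  fixes w :: "'k \<Rightarrow> real ^ 'n::{finite,linorder} \<Rightarrow> real"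
    and w' :: "'l \<Rightarrow> real ^ 'n::{finite,linorder} \<Rightarrow> real"
  assumes nonneg: "0 < C" "\<And>k x. 0 \<le> w' k x"
    and le: "\<And>k x. \<exists>k'. w k x \<le> C * w' k' x"
  shows "weighted_norm w m f \<le> ereal C * weighted_norm w' m f"
proof (rule weighted_norm_least)
  fix k x and \<alpha> :: "nat ^ 'n::{finite,linorder}" assume \<alpha>: "mi_abs \<alpha> \<le> m"
  obtain k' where k': "w k x \<le> C * w' k' x" using le by blast
  have "w k x * cmod (mi_deriv \<alpha> f x) \<le> C * (w' k' x * cmod (mi_deriv \<alpha> f x))"
    using mult_right_mono[OF k', of "cmod (mi_deriv \<alpha> f x)"] by (simp add: mult.assoc)
  then have "ereal (w k x * cmod (mi_deriv \<alpha> f x)) \<le>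
      ereal C * ereal (w' k' x * cmod (mi_deriv \<alpha> f x))" by simp
  also have "\<dots> \<le> ereal C * weighted_norm w' m f"
    using nonneg(1) by (intro ereal_mult_left_mono weighted_norm_upper \<alpha>) auto
  finally show "ereal (w k x * cmod (mi_deriv \<alpha> f x)) \<le> ereal C * weighted_norm w' m f" .
qed

lemma weighted_norm_triangle:
  fixes w :: "'k \<Rightarrow> real ^ 'n::{finite,linorder} \<Rightarrow> real"
  assumes nonneg: "\<And>k x. 0 \<le> w k x" and "C_infty f" "C_infty g" "C_infty u"
  shows "weighted_norm w m (\<lambda>x. f x - u x) \<le>
    weighted_norm w m (\<lambda>x. f x - g x) + weighted_norm w m (\<lambda>x. g x - u x)"
proof (rule weighted_norm_least)
  fix k x and \<alpha> :: "nat ^ 'n::{finite,linorder}" assume \<alpha>: "mi_abs \<alpha> \<le> m"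
  let ?D = "\<lambda>a b. mi_deriv \<alpha> (\<lambda>x. a x - b x) x"
  have "cmod (?D f u) \<le> cmod (?D f g) + cmod (?D g u)"
    using assms norm_triangle_ineq[of "?D f g" "?D g u"] by (simp add: mi_deriv_diff)
  then have "w k x * cmod (?D f u) \<le> w k x * cmod (?D f g) + w k x * cmod (?D g u)"
    using mult_left_mono[OF _ nonneg] by (simp add: distrib_left[symmetric])
  then have "ereal (w k x * cmod (?D f u)) \<le>
      ereal (w k x * cmod (?D f g)) + ereal (w k x * cmod (?D g u))" by simp
  also have "\<dots> \<le> weighted_norm w m (\<lambda>x. f x - g x) + weighted_norm w m (\<lambda>x. g x - u x)"
    by (intro add_mono weighted_norm_upper \<alpha>)
  finally show "ereal (w k x * cmod (?D f u)) \<le>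
      weighted_norm w m (\<lambda>x. f x - g x) + weighted_norm w m (\<lambda>x. g x - u x)" .
qed

lemma weighted_norm_zero:
  fixes w :: "'k \<Rightarrow> real ^ 'n::{finite,linorder} \<Rightarrow> real"
  assumes "C_infty f"
  shows "weighted_norm w m (\<lambda>x. f x - f x) \<le> 0"
proof (rule weighted_norm_least)
  fix k x and \<alpha> :: "nat ^ 'n::{finite,linorder}"
  show "ereal (w k x * cmod (mi_deriv \<alpha> (\<lambda>x. f x - f x) x)) \<le> 0"
    unfolding mi_deriv_diff[OF assms assms] by simp
qed

section \<open>Spaces and topologies given by weight families\<close>

definition weighted_space ::
  "('k \<Rightarrow> real ^ 'n::{finite,linorder} \<Rightarrow> real) \<Rightarrow> (real ^ 'n::{finite,linorder} \<Rightarrow> complex) set" where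
  "weighted_space w = {f. C_infty f \<and> (\<forall>m. weighted_norm w m f < \<infinity>)}"

text \<open>Each \<open>f\<close> of the space lies in the unit ball centred at itself, so the
  subbasic balls cover it.\<close>

lemma topspace_weighted:
  "topspace (seminorm_topology (weighted_space w) (weighted_norm w)) = weighted_space w"
proof -
  let ?S = "{{g \<in> weighted_space w. weighted_norm w m (\<lambda>x. g x - f x) < ereal r} | f m r.
    f \<in> weighted_space w \<and> 0 < r}"
  have "f \<in> \<Union>?S" if f: "f \<in> weighted_space w" for f
  proof -
    have "weighted_norm w 0 (\<lambda>x. f x - f x) < ereal 1"
      using weighted_norm_zero[of f w 0] f by (simp add: weighted_space_def le_less_trans)
    then have "f \<in> {g \<in> weighted_space w. weighted_norm w 0 (\<lambda>x. g x - f x) < ereal 1}"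
      using f by simp
    moreover have "{g \<in> weighted_space w. weighted_norm w 0 (\<lambda>x. g x - f x) < ereal 1} \<in> ?S"
      using f zero_less_one by blast
    ultimately show ?thesis by blast
  qed
  then have "\<Union>?S = weighted_space w" by blast
  then show ?thesis unfolding seminorm_topology_def topology_generated_by_topspace .
qed

lemma weighted_space_mono:
  assumes "0 < C" "\<And>k x. 0 \<le> w k x" "\<And>k x. \<exists>k'. w' k x \<le> C * w k' x"
  shows "weighted_space w \<subseteq> weighted_space w'"
proof
  fix f assume f: "f \<in> weighted_space w"
  have "weighted_norm w' m f < \<infinity>" for m
  proof -
    have "weighted_norm w' m f \<le> ereal C * weighted_norm w m f"
      by (rule weighted_norm_le) (use assms in auto)
    also have "\<dots> < \<infinity>"
      using f weighted_norm_nonneg[of w m f] assms(2)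
      by (cases "weighted_norm w m f") (auto simp: weighted_space_def less_top[symmetric])
    finally show ?thesis .
  qed
  then show "f \<in> weighted_space w'" using f by (simp add: weighted_space_def)
qed

text \<open>The same \<open>m\<close> serves on both sides: the target norm is at most
  \<open>C\<close> times the source norm. It remains to show that a subbasic target ball, cut down
  to the source space, is a neighbourhood of each of its points.\<close>

lemma continuous_map_weighted_inclusion:
  fixes w :: "'k \<Rightarrow> real ^ 'n::{finite,linorder} \<Rightarrow> real"
    and w' :: "'l \<Rightarrow> real ^ 'n::{finite,linorder} \<Rightarrow> real"
  assumes C: "0 < C" and w: "\<And>k x. 0 \<le> w k x" and w': "\<And>k x. 0 \<le> w' k x"
    and le: "\<And>k x. \<exists>k'. w' k x \<le> C * w k' x"
  shows "continuous_map (seminorm_topology (weighted_space w) (weighted_norm w))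
    (seminorm_topology (weighted_space w') (weighted_norm w')) (\<lambda>f. f)"
    (is "continuous_map ?X _ _")
  unfolding seminorm_topology_def[of "weighted_space w'"]
proof (rule continuous_on_generated_topo)
  let ?E = "weighted_space w" and ?E' = "weighted_space w'"
  have sub: "?E \<subseteq> ?E'" by (rule weighted_space_mono) (use assms in auto)
  fix U assume "U \<in> {{g \<in> ?E'. weighted_norm w' m (\<lambda>x. g x - f x) < ereal r} | f m r.
    f \<in> ?E' \<and> 0 < r}"
  then obtain f m r where U: "U = {g \<in> ?E'. weighted_norm w' m (\<lambda>x. g x - f x) < ereal r}"
    and f: "f \<in> ?E'" by blast
  have "\<exists>V. openin ?X V \<and> g0 \<in> V \<and> V \<subseteq> U \<inter> ?E" if g0: "g0 \<in> U \<inter> ?E" for g0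
  proof -
    obtain s where s: "weighted_norm w' m (\<lambda>x. g0 x - f x) = ereal s" "s < r"
      using g0 weighted_norm_nonneg[of w' m "\<lambda>x. g0 x - f x"] w' unfolding U
      by (cases "weighted_norm w' m (\<lambda>x. g0 x - f x)") auto
    \<comment> \<open>The slack left by the distance \<open>s\<close> of \<open>g0\<close> from the
      centre \<open>f\<close>, divided by the norm of the inclusion, so that
      \<open>C * d + s = r\<close>.\<close>
    define d where "d = (r - s) / C"
    have d: "0 < d" using s(2) C by (simp add: d_def)
    define V where "V = {g \<in> ?E. weighted_norm w m (\<lambda>x. g x - g0 x) < ereal d}"
    have "openin ?X V"
      unfolding seminorm_topology_def
      by (rule topology_generated_by_Basis) (use g0 d in \<open>auto simp: V_def\<close>)
    moreover have "g0 \<in> V"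
      using weighted_norm_zero[of g0 w m] g0 d
      by (simp add: V_def weighted_space_def le_less_trans)
    moreover have "V \<subseteq> U \<inter> ?E"
    proof
      fix g assume g: "g \<in> V"
      have "weighted_norm w' m (\<lambda>x. g x - f x) \<le>
          weighted_norm w' m (\<lambda>x. g x - g0 x) + ereal s"
        unfolding s(1)[symmetric]
        by (rule weighted_norm_triangle) (use w' g g0 f in \<open>auto simp: V_def weighted_space_def\<close>)
      also have "\<dots> \<le> ereal C * weighted_norm w m (\<lambda>x. g x - g0 x) + ereal s"
        by (intro add_right_mono weighted_norm_le) (use assms in auto)
      also have "\<dots> < ereal r"
        using g weighted_norm_nonneg[of w m "\<lambda>x. g x - g0 x"] w C
        by (cases "weighted_norm w m (\<lambda>x. g x - g0 x)") (auto simp: V_def d_def field_simps)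
      finally show "g \<in> U \<inter> ?E" using g sub by (auto simp: U V_def)
    qed
    ultimately show ?thesis by blast
  qed
  then have "openin ?X (U \<inter> ?E)" using openin_subopen[of ?X "U \<inter> ?E"] by blast
  then show "openin ?X ((\<lambda>f. f) -` U \<inter> topspace ?X)"
    unfolding topspace_weighted by simp
next
  have "weighted_space w \<subseteq> weighted_space w'" by (rule weighted_space_mono) (use assms in auto)
  then show "(\<lambda>f. f) ` topspace ?X \<subseteq> \<Union>{{g \<in> weighted_space w'.
      weighted_norm w' m (\<lambda>x. g x - f x) < ereal r} | f m r. f \<in> weighted_space w' \<and> 0 < r}"
    using topspace_weighted[of w] topspace_weighted[of w']
    unfolding seminorm_topology_def by simp
qed


section \<open>Interleaved sequences of spaces\<close>

text \<open>Each inclusion of \<open>X \<nu>\<close> into \<open>T\<close> factors through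
  \<open>Y (Suc \<nu>)\<close>; equality of the unions lets the local convexity condition carry
  over.\<close>

lemma lc_candidate_interleaved:
  assumes XY: "\<And>\<nu>. continuous_map (X \<nu>) (Y (Suc \<nu>)) (\<lambda>f. f)"
    and un: "(\<Union>\<nu>. topspace (X \<nu>)) = (\<Union>\<nu>. topspace (Y \<nu>))"
    and T: "lc_candidate Y T"
  shows "lc_candidate X T"
proof -
  have "continuous_map (X \<nu>) T (\<lambda>f. f)" for \<nu>
    using continuous_map_compose[OF XY[of \<nu>], of T "\<lambda>f. f"] T
    by (simp add: lc_candidate_def o_def)
  then show ?thesis using T by (simp add: lc_candidate_def un)
qed

lemma Union_topspace_interleaved:
  assumes "\<And>\<nu>. continuous_map (X \<nu>) (Y (Suc \<nu>)) (\<lambda>f. f)"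
  shows "(\<Union>\<nu>. topspace (X \<nu>)) \<subseteq> (\<Union>\<nu>. topspace (Y \<nu>))"
  using continuous_map_image_subset_topspace[OF assms] by fastforce

text \<open>The limit topology is generated from its candidates alone, and both sequences have the
  same candidates.\<close>

lemma lc_inductive_limit_interleaved:
  assumes XY: "\<And>\<nu>. continuous_map (X \<nu>) (Y (Suc \<nu>)) (\<lambda>f. f)"
    and YX: "\<And>\<nu>. continuous_map (Y \<nu>) (X (Suc \<nu>)) (\<lambda>f. f)"
  shows "(\<Union>\<nu>. topspace (X \<nu>)) = (\<Union>\<nu>. topspace (Y \<nu>))"
    and "lc_inductive_limit X = lc_inductive_limit Y"
proof -
  show un: "(\<Union>\<nu>. topspace (X \<nu>)) = (\<Union>\<nu>. topspace (Y \<nu>))"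
    using Union_topspace_interleaved[of X Y] Union_topspace_interleaved[of Y X] XY YX by blast
  have "lc_candidate X T \<longleftrightarrow> lc_candidate Y T" for T
    using lc_candidate_interleaved[of X Y T] lc_candidate_interleaved[of Y X T] XY YX un by metis
  then show "lc_inductive_limit X = lc_inductive_limit Y"
    by (simp add: lc_inductive_limit_def)
qed


section \<open>Conjugates\<close>

lemma real_conj_le:
  fixes g :: "real ^ 'n::finite \<Rightarrow> real"
  assumes fin: "\<bar>young_conj (\<lambda>y. ereal (g y)) x\<bar> \<noteq> \<infinity>"
    and le: "\<And>y. x \<bullet> y - g y \<le> c"
  shows "real_conj g x \<le> c"
proof -
  have "young_conj (\<lambda>y. ereal (g y)) x \<le> ereal c"
    unfolding young_conj_def by (rule SUP_least) (simp add: le)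
  then show ?thesis
    using fin unfolding real_conj_def by (metis ereal_real ereal_less_eq(3))
qed

text \<open>A near-maximiser in the supremum; the slack 1 only enters the constants.\<close>

lemma real_conj_approx:
  fixes g :: "real ^ 'n::finite \<Rightarrow> real"
  assumes "\<bar>young_conj (\<lambda>y. ereal (g y)) x\<bar> \<noteq> \<infinity>"
  obtains y where "real_conj g x \<le> x \<bullet> y - g y + 1"
proof -
  have "\<not> (\<forall>y. x \<bullet> y - g y \<le> real_conj g x - 1)"
    using real_conj_le[OF assms, of "real_conj g x - 1"] by auto
  then obtain y where "real_conj g x - 1 < x \<bullet> y - g y" by (auto simp: not_le)
  then show thesis by (intro that[of y]) simp
qed

text \<open>The point one unit below the graph at \<open>b\<close> is strictly separated from the
  closed epigraph; the parallel hyperplane through that point is the required affine minorant. The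
  unit lost costs only a factor \<open>exp 1\<close> in the weights.\<close>

lemma convex_approx_subgradient:
  fixes g :: "'a::euclidean_space \<Rightarrow> real"
  assumes conv: "convex_on UNIV g"
  obtains t where "\<And>z. g b - 1 + t \<bullet> (z - b) \<le> g z"
proof -
  have cont: "continuous_on UNIV g"
    using conv by (intro convex_on_continuous) auto
  have "closed {xy. g (fst xy) \<le> snd xy}"
    by (intro closed_Collect_le continuous_intros continuous_on_compose2[OF cont]) auto
  then have cl: "closed (epigraph UNIV g)"
    by (simp add: epigraph_def)
  have "(b, g b - 1) \<notin> epigraph UNIV g"
    by (simp add: epigraph_def)
  then obtain p c where p: "p \<bullet> (b, g b - 1) < c"
    "\<And>u. u \<in> epigraph UNIV g \<Longrightarrow> c < p \<bullet> u"
    using separating_hyperplane_closed_point[OF convex_epigraphI[OF conv] cl] by blast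
  obtain p1 p2 where pp: "p = (p1, p2)" by (cases p)
  have 1: "p1 \<bullet> b + p2 * (g b - 1) < p1 \<bullet> z + p2 * g z" for z
    using p(1) p(2)[of "(z, g z)"] by (simp add: pp epigraph_def)
  \<comment> \<open>At \<open>z = b\<close> the \<open>p1\<close> terms cancel, so the hyperplane is
    not vertical and its equation can be solved for the last coordinate.\<close>
  have p2: "0 < p2" using 1[of b] by (simp add: algebra_simps)
  show thesis
  proof (rule that[of "- (1 / p2) *\<^sub>R p1"])
    fix z
    have "g b - 1 + (p1 \<bullet> b - p1 \<bullet> z) / p2 < g z"
      using 1[of z] p2 by (simp add: field_simps)
    then show "g b - 1 + (- (1 / p2) *\<^sub>R p1) \<bullet> (z - b) \<le> g z"
      by (simp add: inner_diff_right diff_divide_distrib)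
  qed
qed

lemma inner_vec_real: "(x :: real ^ 'n::finite) \<bullet> y = (\<Sum>i\<in>UNIV. x $ i * y $ i)"
  by (simp add: inner_vec_def)

lemma inner_le_inner_abs:
  fixes x y :: "real ^ 'n::finite"
  shows "x \<bullet> y \<le> (\<chi> i. \<bar>x $ i\<bar>) \<bullet> (\<chi> i. \<bar>y $ i\<bar>)"
  unfolding inner_vec_real by (intro sum_mono) (simp add: abs_mult[symmetric])

text \<open>
  Symmetry of \<open>g\<close> allows the signs of an arbitrary approximate subgradient to be discarded.
\<close>

lemma symmetric_convex_approx_subgradient:
  fixes g :: "real ^ 'n::finite \<Rightarrow> real"
  assumes conv: "convex_on UNIV g"
    and sym: "\<And>x. g x = g (\<chi> i. \<bar>x $ i\<bar>)" and b: "b \<in> orthant"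
  obtains t where "t \<in> orthant" "\<And>z. g b - 1 + t \<bullet> (z - b) \<le> g z"
proof -
  obtain s where s: "\<And>z. g b - 1 + s \<bullet> (z - b) \<le> g z"
    using convex_approx_subgradient[OF conv] by blast
  define t :: "real ^ 'n" where "t = (\<chi> i. \<bar>s $ i\<bar>)"
  show thesis
  proof (rule that[of t])
    show "t \<in> orthant" by (simp add: t_def orthant_def)
    fix z
    \<comment> \<open>Flipping the coordinates where \<open>s\<close> is negative leaves
      \<open>g\<close> unchanged and turns the pairing with \<open>s\<close> into the pairing with
      \<open>t\<close>.\<close>
    define z' :: "real ^ 'n" where "z' = (\<chi> i. if s $ i < 0 then - z $ i else z $ i)"
    have "(\<chi> i. \<bar>z' $ i\<bar>) = (\<chi> i. \<bar>z $ i\<bar>)" by (simp add: z'_def vec_eq_iff)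
    then have "g z' = g z" using sym[of z'] sym[of z] by simp
    moreover have "s \<bullet> z' = t \<bullet> z"
      unfolding inner_vec_real by (intro sum.cong) (auto simp: z'_def t_def)
    moreover have "s \<bullet> b \<le> t \<bullet> b"
      unfolding inner_vec_real
      by (intro sum_mono mult_right_mono) (use b in \<open>auto simp: t_def orthant_def\<close>)
    ultimately show "g b - 1 + t \<bullet> (z - b) \<le> g z"
      using s[of z'] by (simp add: inner_diff_right)
  qed
qed


section \<open>Comparison of the weights\<close>

definition G_weight ::
  "(real ^ 'n::finite \<Rightarrow> real) \<Rightarrow> nat ^ 'n \<Rightarrow> real ^ 'n \<Rightarrow> real" where
  "G_weight h \<beta> x = \<bar>mi_power x \<beta>\<bar> / (mi_fact \<beta> * exp (- h (mi_vec \<beta>)))"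

text \<open>The \<open>unit\<close> argument gives this single weight the shape of a family.\<close>

definition GS_weight :: "(real ^ 'n::finite \<Rightarrow> real) \<Rightarrow> unit \<Rightarrow> real ^ 'n \<Rightarrow> real" where
  "GS_weight M k x = exp (M x)"

lemma mi_fact_pos: "0 < mi_fact \<alpha>"
  unfolding mi_fact_def by (intro prod_pos) simp

lemma mi_vec_orthant: "mi_vec \<beta> \<in> orthant"
  by (simp add: mi_vec_def orthant_def)

lemma abs_mi_power: "\<bar>mi_power x \<beta>\<bar> = (\<Prod>i\<in>UNIV. \<bar>x $ i\<bar> ^ (\<beta> $ i))"
  by (simp add: mi_power_def abs_prod power_abs)

lemma G_weight_nonneg: "0 \<le> G_weight h \<beta> x"
  unfolding G_weight_def using mi_fact_pos[of \<beta>] by simp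

lemma G_norm_weighted:
  fixes h :: "real ^ 'n::{finite,linorder} \<Rightarrow> real"
  shows "G_norm h = weighted_norm (G_weight h)"
proof (intro ext)
  fix m and f :: "real ^ 'n::{finite,linorder} \<Rightarrow> complex"
  \<comment> \<open>The supremum is reindexed along a permutation of the triple, since
    \<open>weighted_norm\<close> puts the parameter first.\<close>
  have "(\<lambda>(x, \<beta>, \<alpha>). (\<beta>, x, \<alpha>)) `
      {(x :: real ^ 'n::{finite,linorder}, \<beta> :: nat ^ 'n::{finite,linorder}, \<alpha>). mi_abs \<alpha> \<le> m} =
    {(\<beta>, x, \<alpha>). mi_abs \<alpha> \<le> m}"
    by force
  note swap = this[symmetric]
  show "G_norm h m f = weighted_norm (G_weight h) m f"
    unfolding weighted_norm_def swap image_image G_norm_def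
    by (intro SUP_cong) (auto simp: G_weight_def norm_mult)
qed

lemma GS_norm_weighted:
  fixes M :: "real ^ 'n::{finite,linorder} \<Rightarrow> real"
  shows "GS_norm M = weighted_norm (GS_weight M)"
proof (intro ext)
  fix m and f :: "real ^ 'n::{finite,linorder} \<Rightarrow> complex"
  have "Pair () ` {(x :: real ^ 'n::{finite,linorder}, \<alpha>). mi_abs \<alpha> \<le> m} =
    {(k, x, \<alpha>). mi_abs \<alpha> \<le> m}"
    by force
  note swap = this[symmetric]
  show "GS_norm M m f = weighted_norm (GS_weight M) m f"
    unfolding weighted_norm_def swap image_image GS_norm_def
    by (intro SUP_cong) (auto simp: GS_weight_def exp_minus divide_inverse mult.commute)
qed

lemma G_space_weighted: "G_space h = weighted_space (G_weight h)"
  unfolding G_space_def G_m_space_def weighted_space_def C_infty_def G_norm_weighted by auto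

lemma GS_space_weighted: "GS_space M = weighted_space (GS_weight M)"
  unfolding GS_space_def GS_m_space_def weighted_space_def C_infty_def GS_norm_weighted by auto

section \<open>Terms of the exponential series against its sum\<close>

lemma power_le_fact_mult_exp:
  fixes u :: real
  assumes "0 \<le> u"
  shows "u ^ k \<le> fact k * exp u"
proof -
  have "(\<Sum>n\<in>{k}. u ^ n /\<^sub>R fact n) \<le> exp u"
    unfolding exp_def
    by (rule sum_le_suminf) (use assms in \<open>auto simp: summable_exp\<close>)
  then show ?thesis by (simp add: field_simps)
qed

text \<open>If every term failed, \<open>u ^ k / fact k\<close> would stay below
  \<open>exp u / 4 / 2 ^ k\<close> for all \<open>k\<close>, and summation would give
  \<open>exp u \<le> exp u / 2\<close>.\<close>

lemma exp_le_power_term: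
  fixes u :: real
  assumes "0 \<le> u"
  shows "\<exists>k. exp u \<le> 4 * (2 * u) ^ k / fact k"
proof (rule ccontr)
  assume "\<not> ?thesis"
  then have lt: "4 * (2 * u) ^ k / fact k < exp u" for k by (simp add: not_le)
  have le: "u ^ k /\<^sub>R fact k \<le> exp u / 4 * (1 / 2) ^ k" for k
  proof -
    have "4 * (2 ^ k * (u ^ k / fact k)) < exp u"
      using lt[of k] by (simp add: power_mult_distrib)
    then have "u ^ k / fact k < exp u / 4 / 2 ^ k"
      by (simp add: pos_less_divide_eq mult.commute mult.left_commute)
    moreover have "(1 / 2 :: real) ^ k = 1 / 2 ^ k" by (rule power_one_over)
    moreover have "u ^ k /\<^sub>R fact k = u ^ k / fact k" by (simp add: divide_inverse_commute)
    ultimately show ?thesis by simp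
  qed
  have "(\<lambda>k. exp u / 4 * (1 / 2 :: real) ^ k) sums (exp u / 4 * 2)"
    using geometric_sums[of "1/2 :: real"] by (intro sums_mult) simp
  then have "exp u \<le> exp u / 4 * 2"
    by (rule sums_le[OF le exp_converges])
  then show False by simp
qed

text \<open>For fixed \<beta> and \<open>x\<close>, Young's inequality for \<open>phi h\<close> is
  applied at one point \<open>y\<close> with \<open>\<bar>y $ i\<bar> = exp (t $ i)\<close>, where
  \<open>t\<close> is an approximate subgradient of \<open>h'\<close> at \<beta>.\<close>

lemma G_weight_le_GS_weight:
  fixes h h' :: "real ^ 'n::finite \<Rightarrow> real"
  assumes fin: "\<And>x. \<bar>young_conj (\<lambda>y. ereal (h y)) x\<bar> \<noteq> \<infinity>"
    and phi_fin: "\<And>x. \<bar>young_conj (\<lambda>y. ereal (phi h y)) x\<bar> \<noteq> \<infinity>"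
    and sym: "\<And>x. h x = h (\<chi> i. \<bar>x $ i\<bar>)"
    and conv': "convex_on UNIV h'" and sym': "\<And>x. h' x = h' (\<chi> i. \<bar>x $ i\<bar>)"
    and gap: "\<And>x. x \<in> orthant \<Longrightarrow> h x - h' x \<ge> ln 2 * (\<Sum>j\<in>UNIV. x $ j) - \<gamma>"
  shows "G_weight h' \<beta> x \<le> exp (\<gamma> + 1) * GS_weight (real_conj (phi h)) k x"
proof -
  obtain t where t: "t \<in> orthant" "\<And>z. h' (mi_vec \<beta>) - 1 + t \<bullet> (z - mi_vec \<beta>) \<le> h' z"
    using symmetric_convex_approx_subgradient[OF conv' sym' mi_vec_orthant] by blast
  \<comment> \<open>The signs follow those of \<open>x\<close>, so that no cancellation occurs in
    the inner product of \<open>x\<close> and \<open>y\<close>.\<close>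
  define y :: "real ^ 'n" where "y = (\<chi> i. if x $ i < 0 then - exp (t $ i) else exp (t $ i))"
  define l :: "real ^ 'n" where "l = (\<chi> i. ln (1 + exp (t $ i)))"
  have absy: "\<bar>y $ i\<bar> = exp (t $ i)" for i by (simp add: y_def)
  have l: "0 \<le> l $ i" "l $ i \<le> t $ i + ln 2" for i
  proof -
    show "0 \<le> l $ i" by (simp add: l_def)
    \<comment> \<open>Here \<open>t $ i \<ge> 0\<close> enters. The resulting excess
      \<open>ln 2\<close> in each coordinate is what the gap between \<open>h\<close> and
      \<open>h'\<close> pays for.\<close>
    have "1 + exp (t $ i) \<le> exp (t $ i) * 2"
      using t(1) by (simp add: orthant_def)
    then have "l $ i \<le> ln (exp (t $ i) * 2)" unfolding l_def by (simp add: add_pos_pos)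
    then show "l $ i \<le> t $ i + ln 2" by (simp add: ln_mult)
  qed
  have "phi h y = real_conj h l" by (simp add: phi_def l_def absy)
  also have "real_conj h l \<le> t \<bullet> mi_vec \<beta> - h' (mi_vec \<beta>) + 1 + \<gamma>"
  proof (rule real_conj_le[OF fin])
    fix z
    define a :: "real ^ 'n" where "a = (\<chi> i. \<bar>z $ i\<bar>)"
    have a: "a \<in> orthant" by (simp add: a_def orthant_def)
    have "l \<bullet> z \<le> l \<bullet> a"
      unfolding inner_vec_real a_def by (intro sum_mono mult_left_mono) (auto simp: l)
    also have "\<dots> \<le> (\<Sum>i\<in>UNIV. (t $ i + ln 2) * a $ i)"
      unfolding inner_vec_real by (intro sum_mono mult_right_mono) (auto simp: l a_def)
    also have "\<dots> = t \<bullet> a + ln 2 * (\<Sum>i\<in>UNIV. a $ i)"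
      by (simp add: inner_vec_real distrib_right sum.distrib sum_distrib_left)
    finally have "l \<bullet> z - h z \<le> t \<bullet> a - h' a + \<gamma>"
      using gap[OF a] sym[of z] by (simp add: a_def)
    then show "l \<bullet> z - h z \<le> t \<bullet> mi_vec \<beta> - h' (mi_vec \<beta>) + 1 + \<gamma>"
      using t(2)[of a] by (simp add: inner_diff_right)
  qed
  finally have phi_le: "phi h y \<le> t \<bullet> mi_vec \<beta> - h' (mi_vec \<beta>) + 1 + \<gamma>" .
  have xy: "x \<bullet> y = (\<Sum>i\<in>UNIV. \<bar>x $ i\<bar> * exp (t $ i))"
    unfolding inner_vec_real by (intro sum.cong) (auto simp: y_def)
  have "\<bar>mi_power x \<beta>\<bar> * exp (t \<bullet> mi_vec \<beta>) = (\<Prod>i\<in>UNIV. (\<bar>x $ i\<bar> * exp (t $ i)) ^ (\<beta> $ i))"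
    by (simp add: abs_mi_power inner_vec_real exp_sum mi_vec_def power_mult_distrib prod.distrib
        exp_of_nat2_mult)
  also have "\<dots> \<le> (\<Prod>i\<in>UNIV. fact (\<beta> $ i) * exp (\<bar>x $ i\<bar> * exp (t $ i)))"
    by (intro prod_mono conjI power_le_fact_mult_exp) auto
  also have "\<dots> = mi_fact \<beta> * exp (x \<bullet> y)"
    by (simp add: mi_fact_def xy exp_sum prod.distrib)
  finally have "\<bar>mi_power x \<beta>\<bar> / mi_fact \<beta> \<le> exp (x \<bullet> y - t \<bullet> mi_vec \<beta>)"
    using mi_fact_pos[of \<beta>] by (simp add: exp_diff field_simps)
  \<comment> \<open>Young's inequality bounds the inner product by the conjugate at \<open>x\<close>
    plus \<open>phi h y\<close>; the pairing of \<open>t\<close> with \<beta> then cancels against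
    \<open>phi_le\<close>.\<close>
  also have "\<dots> \<le> exp (real_conj (phi h) x + \<gamma> + 1 - h' (mi_vec \<beta>))"
    using real_conj_ge[OF phi_fin, of x y] phi_le by simp
  finally have "\<bar>mi_power x \<beta>\<bar> / mi_fact \<beta> * exp (h' (mi_vec \<beta>)) \<le>
      exp (real_conj (phi h) x + \<gamma> + 1 - h' (mi_vec \<beta>)) * exp (h' (mi_vec \<beta>))"
    by (rule mult_right_mono) simp
  also have "\<dots> = exp (\<gamma> + 1) * exp (real_conj (phi h) x)"
    by (simp add: exp_add[symmetric])
  finally show ?thesis
    by (simp add: G_weight_def GS_weight_def exp_minus field_simps)
qed

text \<open>Here \<beta> depends on \<open>x\<close>: its entries pick dominating terms of the
  exponential series at \<open>u i\<close>, with \<open>y\<close> a near-maximiser for the conjugate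
  at \<open>x\<close>.\<close>

lemma GS_weight_le_G_weight:
  fixes h h' :: "real ^ 'n::finite \<Rightarrow> real"
  assumes fin': "\<And>x. \<bar>young_conj (\<lambda>y. ereal (h' y)) x\<bar> \<noteq> \<infinity>"
    and phi_fin': "\<And>x. \<bar>young_conj (\<lambda>y. ereal (phi h' y)) x\<bar> \<noteq> \<infinity>"
    and gap: "\<And>x. x \<in> orthant \<Longrightarrow> h x - h' x \<ge> ln 2 * (\<Sum>j\<in>UNIV. x $ j) - \<gamma>"
  shows "\<exists>\<beta>. GS_weight (real_conj (phi h')) k x \<le> (exp (\<gamma> + 1) * 4 ^ CARD('n)) * G_weight h \<beta> x"
proof -
  obtain y where y: "real_conj (phi h') x \<le> x \<bullet> y - phi h' y + 1"
    using real_conj_approx[OF phi_fin'] .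
  define u where "u i = \<bar>x $ i\<bar> * \<bar>y $ i\<bar>" for i
  have "\<forall>i. \<exists>k. exp (u i) \<le> 4 * (2 * u i) ^ k / fact k"
    by (intro allI exp_le_power_term) (simp add: u_def)
  then obtain b where b: "\<And>i. exp (u i) \<le> 4 * (2 * u i) ^ b i / fact (b i)" by metis
  define \<beta> :: "nat ^ 'n" where "\<beta> = (\<chi> i. b i)"
  let ?s = "\<Sum>i\<in>UNIV. mi_vec \<beta> $ i"
  define l :: "real ^ 'n" where "l = (\<chi> i. ln (1 + \<bar>y $ i\<bar>))"
  have "x \<bullet> y \<le> (\<Sum>i\<in>UNIV. u i)"
    using inner_le_inner_abs[of x y] by (simp add: inner_vec_real u_def)
  then have "exp (x \<bullet> y) \<le> (\<Prod>i\<in>UNIV. exp (u i))"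
    by (simp add: exp_sum[symmetric])
  also have "\<dots> \<le> (\<Prod>i\<in>UNIV. 4 * (2 * u i) ^ b i / fact (b i))"
    by (intro prod_mono conjI b) auto
  \<comment> \<open>The powers of 2 are collected as \<open>exp (ln 2 * ?s)\<close> to match the
    form of the gap condition.\<close>
  also have "\<dots> = 4 ^ CARD('n) * exp (ln 2 * ?s) * \<bar>mi_power x \<beta>\<bar> * \<bar>mi_power y \<beta>\<bar> / mi_fact \<beta>"
    by (simp add: prod_dividef prod.distrib power_mult_distrib u_def abs_mi_power mi_fact_def \<beta>_def
        mi_vec_def sum_distrib_left exp_sum exp_of_nat2_mult mult.assoc)
  finally have 1: "exp (x \<bullet> y) \<le>
    4 ^ CARD('n) * exp (ln 2 * ?s) * \<bar>mi_power x \<beta>\<bar> * \<bar>mi_power y \<beta>\<bar> / mi_fact \<beta>" .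
  have "\<bar>mi_power y \<beta>\<bar> \<le> (\<Prod>i\<in>UNIV. (1 + \<bar>y $ i\<bar>) ^ (\<beta> $ i))"
    unfolding abs_mi_power by (intro prod_mono conjI power_mono) auto
  also have "\<dots> = exp (l \<bullet> mi_vec \<beta>)"
    by (simp add: inner_vec_real exp_sum mi_vec_def l_def exp_of_nat2_mult add_pos_nonneg)
  also have "\<dots> \<le> exp (phi h' y + h' (mi_vec \<beta>))"
    using real_conj_ge[OF fin', of l "mi_vec \<beta>"] by (simp add: phi_def l_def)
  finally have 2: "\<bar>mi_power y \<beta>\<bar> \<le> exp (phi h' y + h' (mi_vec \<beta>))" .
  let ?P = "4 ^ CARD('n) * \<bar>mi_power x \<beta>\<bar> / mi_fact \<beta>"
  have P: "0 \<le> ?P" using mi_fact_pos[of \<beta>] by simp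
  have "exp (x \<bullet> y) \<le> ?P * exp (ln 2 * ?s) * \<bar>mi_power y \<beta>\<bar>"
    using 1 by (simp add: mult.assoc mult.left_commute)
  also have "\<dots> \<le> ?P * exp (ln 2 * ?s) * exp (phi h' y + h' (mi_vec \<beta>))"
    by (intro mult_left_mono 2 mult_nonneg_nonneg P) simp
  also have "\<dots> = ?P * exp (ln 2 * ?s + phi h' y + h' (mi_vec \<beta>))"
    by (simp add: exp_add mult.assoc)
  \<comment> \<open>The gap at \<beta> trades \<open>h'\<close> together with the powers of 2 for
    \<open>h\<close> and \<gamma>.\<close>
  also have "\<dots> \<le> ?P * exp (h (mi_vec \<beta>) + \<gamma> + phi h' y)"
    using P gap[OF mi_vec_orthant, of \<beta>] by (intro mult_left_mono) auto
  finally have 3: "exp (x \<bullet> y) \<le> ?P * exp (h (mi_vec \<beta>) + \<gamma> + phi h' y)" .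
  \<comment> \<open>The near-maximality of \<open>y\<close> supplies the factor that cancels
    \<open>exp (phi h' y)\<close>.\<close>
  have "GS_weight (real_conj (phi h')) k x \<le> exp (x \<bullet> y) * exp (1 - phi h' y)"
    using y by (simp add: GS_weight_def exp_add[symmetric])
  also have "\<dots> \<le> ?P * exp (h (mi_vec \<beta>) + \<gamma> + phi h' y) * exp (1 - phi h' y)"
    by (intro mult_right_mono 3) simp
  also have "\<dots> = ?P * exp (h (mi_vec \<beta>) + (\<gamma> + 1))"
    by (simp add: exp_add[symmetric] mult.assoc add.assoc)
  also have "\<dots> = (exp (\<gamma> + 1) * 4 ^ CARD('n)) * G_weight h \<beta> x"
    unfolding exp_add[of "h (mi_vec \<beta>)" "\<gamma> + 1"]
    by (simp add: G_weight_def exp_minus field_simps)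
  finally show ?thesis by blast
qed


theorem theorem5:
  fixes h \<theta> :: "nat \<Rightarrow> real ^ 'n::{finite,linorder} \<Rightarrow> real"
  assumes h_convex: "\<And>\<nu>. convex_on UNIV (h \<nu>)"
    and h_abs: "\<And>\<nu> x. h \<nu> x = h \<nu> (\<chi> i. \<bar>x $ i\<bar>)"
    and h_mono: "\<And>\<nu>. nondecr_each_var (h \<nu>)"
    and h_superlinear: "\<And>\<nu>. filterlim (\<lambda>x. h \<nu> x / norm x) at_top at_infinity"
    and h_upper: "\<And>\<nu> M. M > 0 \<Longrightarrow>
       \<exists>A>0. \<forall>x\<in>orthant. h \<nu> x \<le> (\<Sum>j | x $ j \<noteq> 0. x $ j * ln (x $ j / M)) + A"
    and h_gap: "\<And>\<nu>. \<exists>\<gamma>. \<forall>x\<in>orthant. h \<nu> x - h (Suc \<nu>) x \<ge> ln 2 * (\<Sum>j\<in>UNIV. x $ j) - \<gamma>"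
    and h_add: "\<And>\<nu>. \<exists>l. \<forall>x\<in>orthant. \<forall>y\<in>orthant. h (Suc \<nu>) (x + y) \<le> h \<nu> x + h \<nu> y + l"
    and \<theta>_convex: "\<And>\<nu>. convex_on UNIV (\<theta> \<nu>)"
    and \<theta>_abs: "\<And>\<nu> x. \<theta> \<nu> x = \<theta> \<nu> (\<chi> i. \<bar>x $ i\<bar>)"
    and \<theta>_mono: "\<And>\<nu>. nondecr_each_var (\<theta> \<nu>)"
    and \<theta>_close: "\<And>\<nu>. \<exists>a>0. \<forall>x. \<bar>phi (h \<nu>) x - \<theta> \<nu> x\<bar> \<le> a"
  shows "(\<Union>\<nu>. G_space (h \<nu>)) = (\<Union>\<nu>. GS_space (real_conj (phi (h \<nu>))))
    \<and> G_limit h = GS_limit (\<lambda>\<nu>. real_conj (phi (h \<nu>)))"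
proof -
  let ?M = "\<lambda>\<nu>. real_conj (phi (h \<nu>))"
  define X where "X \<nu> = seminorm_topology (G_space (h \<nu>)) (G_norm (h \<nu>))" for \<nu>
  define Y where "Y \<nu> = seminorm_topology (GS_space (?M \<nu>)) (GS_norm (?M \<nu>))" for \<nu>
  have fin: "\<bar>young_conj (\<lambda>y. ereal (h \<nu> y)) x\<bar> \<noteq> \<infinity>" for \<nu> x
  proof (rule young_conj_finite[OF superlinear_bounded_below])
    show "continuous_on UNIV (h \<nu>)" using h_convex by (intro convex_on_continuous) auto
  qed (rule h_superlinear)+
  have phi_fin: "\<bar>young_conj (\<lambda>y. ereal (phi (h \<nu>) y)) x\<bar> \<noteq> \<infinity>" for \<nu> x
    by (rule young_conj_finite) (rule phi_superlinear[OF h_convex h_superlinear h_upper], assumption)+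
  \<comment> \<open>Each direction spends the gap between consecutive members of \<open>h\<close>
    once, hence the shift to \<open>Suc \<nu>\<close>.\<close>
  have XY: "continuous_map (X \<nu>) (Y (Suc \<nu>)) (\<lambda>f. f)" for \<nu>
  proof -
    obtain \<gamma> where \<gamma>: "\<forall>x\<in>orthant. h \<nu> x - h (Suc \<nu>) x \<ge> ln 2 * (\<Sum>j\<in>UNIV. x $ j) - \<gamma>"
      using h_gap by blast
    show ?thesis
      unfolding X_def Y_def G_norm_weighted GS_norm_weighted G_space_weighted GS_space_weighted
    proof (rule continuous_map_weighted_inclusion)
      show "\<exists>\<beta>. GS_weight (?M (Suc \<nu>)) k x \<le> (exp (\<gamma> + 1) * 4 ^ CARD('n)) * G_weight (h \<nu>) \<beta> x" for k x
        by (rule GS_weight_le_G_weight[OF fin phi_fin]) (use \<gamma> in blast)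
    qed (auto simp: G_weight_nonneg GS_weight_def)
  qed
  have YX: "continuous_map (Y \<nu>) (X (Suc \<nu>)) (\<lambda>f. f)" for \<nu>
  proof -
    obtain \<gamma> where \<gamma>: "\<forall>x\<in>orthant. h \<nu> x - h (Suc \<nu>) x \<ge> ln 2 * (\<Sum>j\<in>UNIV. x $ j) - \<gamma>"
      using h_gap by blast
    show ?thesis
      unfolding X_def Y_def G_norm_weighted GS_norm_weighted G_space_weighted GS_space_weighted
    proof (rule continuous_map_weighted_inclusion)
      show "\<exists>k. G_weight (h (Suc \<nu>)) \<beta> x \<le> exp (\<gamma> + 1) * GS_weight (?M \<nu>) k x" for \<beta> x
        by (intro exI G_weight_le_GS_weight[OF fin phi_fin h_abs h_convex h_abs]) (use \<gamma> in blast)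
    qed (auto simp: G_weight_nonneg GS_weight_def)
  qed
  have "topspace (X \<nu>) = G_space (h \<nu>)" "topspace (Y \<nu>) = GS_space (?M \<nu>)" for \<nu>
    unfolding X_def Y_def G_norm_weighted GS_norm_weighted G_space_weighted GS_space_weighted
    by (rule topspace_weighted)+
  moreover have "G_limit h = lc_inductive_limit X" "GS_limit ?M = lc_inductive_limit Y"
    by (simp_all add: G_limit_def GS_limit_def X_def[abs_def] Y_def[abs_def])
  ultimately show ?thesis
    using lc_inductive_limit_interleaved[of X Y, OF XY YX] by simp
qed

end
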